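(* For all $n\ge1$, $t_n\ge\lceil n/2\rceil$. In particular, the sequence $(t_n)_{n\ge1}$ is unbounded.
   Context: For $n\ge 1$, $\mathcal T_n\subseteq 2^{[2n]}$ is the code consisting of: the sets $\{2k-1,2k\}$ for $k=1,\dots,n$; the sets $\{1,3,5,\dots,2n-1\}$ and $\{2,4,6,\dots,2n\}$; all singletons $\{i\}$, $i\in[2n]$; and $\emptyset$. $t_n=\operatorname{odim}(\mathcal T_n)$, where $\operatorname{odim}(\mathcal C)$ is the least $d$ such that there are (possibly empty) convex open sets $U_1,\dots,U_N\subseteq\mathbb R^d$ with $\mathcal C=\{\sigma\subseteq[N] : \bigcap_{i\in\sigma}U_i\setminus\bigcup_{j\notin\sigma}U_j\neq\emptyset\}$ (empty intersection meaning $\mathbb R^d$), or $\infty$ if none exist. *)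

theory Defs
  imports "HOL-Analysis.Analysis"
begin

text \<open>
  The ambient space \<open>\<real>\<^sup>d\<close> is the library's \<^const>\<open>Euclidean_space\<close> \<open>d\<close>, whose points are the
  functions \<open>x :: nat \<Rightarrow> real\<close> with \<open>x i = 0\<close> for all \<open>i \<ge> d\<close>, so that the dimension \<open>d\<close> can be a
  variable. The library's \<^const>\<open>convex\<close> needs the class \<^class>\<open>real_vector\<close>, of which the
  function type is not an instance, so convexity is spelled out coordinatewise.
\<close>

definition convex_fun :: "(nat \<Rightarrow> real) set \<Rightarrow> bool" where
  "convex_fun S \<longleftrightarrow>
     (\<forall>x\<in>S. \<forall>y\<in>S. \<forall>u\<ge>0. \<forall>v\<ge>0. u + v = 1 \<longrightarrow> (\<lambda>i. u * x i + v * y i) \<in> S)"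

text \<open>
  Intersecting with the whole space makes the empty intersection (\<open>\<sigma> = {}\<close>) equal to \<open>\<real>\<^sup>d\<close>.
\<close>

definition code_of_cover :: "nat \<Rightarrow> nat \<Rightarrow> (nat \<Rightarrow> (nat \<Rightarrow> real) set) \<Rightarrow> nat set set" where
  "code_of_cover d N U =
     {\<sigma>. \<sigma> \<subseteq> {1..N} \<and>
          (topspace (Euclidean_space d) \<inter> (\<Inter>i\<in>\<sigma>. U i)) - (\<Union>j\<in>{1..N} - \<sigma>. U j) \<noteq> {}}"

definition open_convex_realizable :: "nat \<Rightarrow> nat set set \<Rightarrow> nat \<Rightarrow> bool" where
  "open_convex_realizable N C d \<longleftrightarrow>
     (\<exists>U. (\<forall>i\<in>{1..N}. openin (Euclidean_space d) (U i) \<and> convex_fun (U i)) \<and>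
          C = code_of_cover d N U)"

text \<open>
  The open embedding dimension of a code \<open>C\<close> on the vertices \<open>{1..N}\<close>. The infimum over
  \<^typ>\<open>enat\<close> is the least element of a nonempty set, and \<open>\<infinity>\<close> for the empty set.
\<close>

definition odim :: "nat \<Rightarrow> nat set set \<Rightarrow> enat" where
  "odim N C = Inf {enat d | d. open_convex_realizable N C d}"

definition code_T :: "nat \<Rightarrow> nat set set" where
  "code_T n =
     {{2 * k - 1, 2 * k} | k. k \<in> {1..n}} \<union>
     {{2 * k - 1 | k. k \<in> {1..n}}, {2 * k | k. k \<in> {1..n}}} \<union>
     {{i} | i. i \<in> {1..2 * n}} \<union>
     {{}}"

definition t_seq :: "nat \<Rightarrow> enat" where
  "t_seq n = odim (2 * n) (code_T n)"

end

theory Submission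
  imports Defs "HOL-Library.Function_Algebras"
begin

text \<open>
  The odd sets \<open>U\<^sub>1, U\<^sub>3, \<dots>\<close> of a realization of \<open>\<T>\<^sub>n\<close> pairwise meet only in their common
  intersection \<open>O\<close>, the even ones only in \<open>E\<close>, and \<open>O\<close>, \<open>E\<close> are disjoint. Separate them by a
  hyperplane and choose \<open>y\<^sub>k \<in> U\<^bsub>2k-1\<^esub> \<inter> U\<^bsub>2k\<^esub>\<close>. If \<open>n > 2d\<close>, then \<open>d + 1\<close> of the \<open>y\<^sub>k\<close>
  lie on one side, and their convex hull misses \<open>O\<close> or \<open>E\<close>. This contradicts Jeffs' sunflower
  theorem: in dimension \<open>d\<close>, points chosen from \<open>d + 1\<close> petals of a sunflower of convex open sets
  have a convex hull meeting the center.

  The sunflower theorem is proved by induction on the dimension. Shrink the points towards a point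
  of the center \<open>W\<close> until their hull just touches the closure of \<open>W\<close>, at \<open>z\<close> say. All petals but
  one lie strictly on one side of a hyperplane through \<open>z\<close>, and a parallel hyperplane close to it
  cuts them in a sunflower of one dimension less that is again a counterexample.
\<close>

section \<open>Openness along lines and invariance under a subspace\<close>

text \<open>
  Only openness along lines is used, so no topology is needed on the vector space. The dimension
  enters as a codimension: sets invariant under a subspace \<open>L\<close> that together with a finite set \<open>B\<close>
  spans everything live in dimension at most \<open>card B\<close>. Passing to a hyperplane section then
  means enlarging \<open>L\<close> and keeps the ambient type.
\<close>

definition alg_open :: "'a::real_vector set \<Rightarrow> bool" where
  "alg_open S \<longleftrightarrow> (\<forall>x\<in>S. \<forall>v. \<exists>e>0. \<forall>t. 0 \<le> t \<and> t \<le> e \<longrightarrow> x + t *\<^sub>R v \<in> S)"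

definition invariant_under :: "'a::real_vector set \<Rightarrow> 'a set \<Rightarrow> bool" where
  "invariant_under L S \<longleftrightarrow> (\<forall>x\<in>S. \<forall>l\<in>L. x + l \<in> S)"

lemma alg_openD:
  assumes "alg_open S" "x \<in> S"
  obtains e where "e > 0" "\<And>t. 0 \<le> t \<Longrightarrow> t \<le> e \<Longrightarrow> x + t *\<^sub>R v \<in> S"
  using assms unfolding alg_open_def by meson

text \<open>The shape \<open>a + f x\<close> serves translations, the reflection
  \<open>z + - x\<close> and the projection onto a hyperplane section alike.\<close>

lemma alg_open_affine_vimage:
  assumes "alg_open S" "linear f"
  shows "alg_open {x. a + f x \<in> S}"
  unfolding alg_open_def
proof (intro ballI allI)
  fix x v assume "x \<in> {x. a + f x \<in> S}"
  then obtain e where e: "e > 0" "\<And>t. 0 \<le> t \<Longrightarrow> t \<le> e \<Longrightarrow> (a + f x) + t *\<^sub>R f v \<in> S"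
    using assms(1) alg_openD by (metis mem_Collect_eq)
  then show "\<exists>e>0. \<forall>t. 0 \<le> t \<and> t \<le> e \<longrightarrow> x + t *\<^sub>R v \<in> {x. a + f x \<in> S}"
    by (intro exI[of _ e]) (simp add: linear_add[OF assms(2)] linear_scale[OF assms(2)] add.assoc)
qed

lemma convex_affine_vimage:
  assumes "convex S" "linear f"
  shows "convex {x. a + f x \<in> S}"
proof (rule convexI)
  fix x y and u v :: real
  assume *: "x \<in> {x. a + f x \<in> S}" "y \<in> {x. a + f x \<in> S}" "0 \<le> u" "0 \<le> v" "u + v = 1"
  then have "u *\<^sub>R (a + f x) + v *\<^sub>R (a + f y) \<in> S"
    using convexD[OF assms(1)] by simp
  moreover have "u *\<^sub>R (a + f x) + v *\<^sub>R (a + f y) = a + f (u *\<^sub>R x + v *\<^sub>R y)"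
    using \<open>u + v = 1\<close>
    by (simp add: linear_add[OF assms(2)] linear_scale[OF assms(2)] algebra_simps flip: scaleR_add_left)
  ultimately show "u *\<^sub>R x + v *\<^sub>R y \<in> {x. a + f x \<in> S}" by simp
qed

lemma alg_open_UN:
  assumes "\<And>j. j \<in> J \<Longrightarrow> alg_open (U j)"
  shows "alg_open (\<Union>j\<in>J. U j)"
  unfolding alg_open_def
proof (intro ballI allI)
  fix x v assume "x \<in> (\<Union>j\<in>J. U j)"
  then obtain j where j: "j \<in> J" "x \<in> U j" by blast
  then obtain e where "e > 0" "\<And>t. 0 \<le> t \<Longrightarrow> t \<le> e \<Longrightarrow> x + t *\<^sub>R v \<in> U j"
    using assms alg_openD by metis
  then show "\<exists>e>0. \<forall>t. 0 \<le> t \<and> t \<le> e \<longrightarrow> x + t *\<^sub>R v \<in> (\<Union>j\<in>J. U j)"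
    using j(1) by (intro exI[of _ e]) blast
qed

lemma invariant_under_UN:
  assumes "\<And>j. j \<in> J \<Longrightarrow> invariant_under L (U j)"
  shows "invariant_under L (\<Union>j\<in>J. U j)"
  using assms unfolding invariant_under_def by fast

text \<open>The points of the hull that can be moved a little in every direction within the hull
  form a convex set containing \<open>T\<close>, hence they are the whole hull.\<close>

lemma alg_open_convex_hull:
  assumes "alg_open T"
  shows "alg_open (convex hull T)"
proof -
  let ?K = "convex hull T"
  define D where "D = {x \<in> ?K. \<forall>v. \<exists>e>0. \<forall>t. 0 \<le> t \<and> t \<le> e \<longrightarrow> x + t *\<^sub>R v \<in> ?K}"
  have "T \<subseteq> D"
    unfolding D_def using assms hull_subset[of T convex] unfolding alg_open_def by blast
  moreover have "convex D"
  proof (rule convexI)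
    fix x y and a b :: real
    assume xy: "x \<in> D" "y \<in> D" and ab: "0 \<le> a" "0 \<le> b" "a + b = 1"
    have cK: "convex ?K" by simp
    have "\<exists>e>0. \<forall>t. 0 \<le> t \<and> t \<le> e \<longrightarrow> (a *\<^sub>R x + b *\<^sub>R y) + t *\<^sub>R v \<in> ?K" for v
    proof -
      obtain e1 where e1: "e1 > 0" "\<And>t. 0 \<le> t \<Longrightarrow> t \<le> e1 \<Longrightarrow> x + t *\<^sub>R v \<in> ?K"
        using xy(1) unfolding D_def by blast
      obtain e2 where e2: "e2 > 0" "\<And>t. 0 \<le> t \<Longrightarrow> t \<le> e2 \<Longrightarrow> y + t *\<^sub>R v \<in> ?K"
        using xy(2) unfolding D_def by blast
      have "(a *\<^sub>R x + b *\<^sub>R y) + t *\<^sub>R v \<in> ?K" if "0 \<le> t" "t \<le> min e1 e2" for t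
      proof -
        have "a *\<^sub>R (x + t *\<^sub>R v) + b *\<^sub>R (y + t *\<^sub>R v) \<in> ?K"
          using that e1(2) e2(2) ab by (intro convexD[OF cK]) auto
        moreover have "a *\<^sub>R (x + t *\<^sub>R v) + b *\<^sub>R (y + t *\<^sub>R v) = (a *\<^sub>R x + b *\<^sub>R y) + ((a + b) * t) *\<^sub>R v"
          by (simp add: algebra_simps)
        ultimately show ?thesis using ab by simp
      qed
      then show ?thesis using e1(1) e2(1) by (intro exI[of _ "min e1 e2"]) auto
    qed
    moreover have "a *\<^sub>R x + b *\<^sub>R y \<in> ?K"
      using xy ab convexD[OF cK] unfolding D_def by blast
    ultimately show "a *\<^sub>R x + b *\<^sub>R y \<in> D" unfolding D_def by blast
  qed
  ultimately have "?K \<subseteq> D" by (rule hull_minimal)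
  then show ?thesis unfolding alg_open_def D_def by blast
qed

lemma invariant_under_convex_hull:
  assumes "invariant_under L T"
  shows "invariant_under L (convex hull T)"
proof -
  let ?K = "convex hull T"
  have "x + l \<in> ?K" if "x \<in> ?K" "l \<in> L" for x l
  proof -
    have "?K \<subseteq> {x. l + id x \<in> ?K}"
    proof (rule hull_minimal)
      show "T \<subseteq> {x. l + id x \<in> ?K}"
        using assms that(2) hull_subset[of T convex] unfolding invariant_under_def
        by (auto simp: add.commute)
      show "convex {x. l + id x \<in> ?K}"
        by (intro convex_affine_vimage linearI) auto
    qed
    then show ?thesis using that(1) by (auto simp: add.commute)
  qed
  then show ?thesis unfolding invariant_under_def by blast
qed

section \<open>Extension of positive functionals and separation of a point\<close>

text \<open>One Hahn-Banach step, from \<open>V\<close> to the span of \<open>V\<close> and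
  \<open>e\<close>. Points of \<open>S\<close> on one side of \<open>V\<close> bound the value at
  \<open>e\<close> from below, those on the other side from above; convexity makes the bounds
  compatible, and openness makes positivity strict.\<close>

lemma extend_positive_functional:
  assumes S: "convex S" "alg_open S" and V: "subspace V" and f: "linear f"
    and pos: "\<And>x. x \<in> S \<inter> V \<Longrightarrow> (f x :: real) > 0"
  obtains g :: "'a::real_vector \<Rightarrow> real" where "linear g" "\<And>x. x \<in> S \<inter> span (insert e V) \<Longrightarrow> g x > 0"
proof (cases "e \<in> V")
  case True
  then have "span (insert e V) = V" using V by (simp add: insert_absorb span_eq_iff)
  then show ?thesis using that f pos by simp
next
  case False
  obtain A where A: "A \<subseteq> V" "independent A" "V \<subseteq> span A"
    by (metis maximal_independent_subset)
  have sA: "span A = V" using A V by (metis span_subspace)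
  have "independent (insert e A)" using A sA False by (simp add: independent_insert)
  \<comment> \<open>\<open>h\<close> is to be the coordinate along \<open>e\<close>: it is 1 at
    \<open>e\<close> and vanishes on \<open>V\<close>.\<close>
  from linear_independent_extend[OF this, of "\<lambda>x. if x = e then (1::real) else 0"]
  obtain h where h: "linear h" "\<And>x. x \<in> insert e A \<Longrightarrow> h x = (if x = e then (1::real) else 0)"
    by blast
  have he: "h e = 1" using h(2) by simp
  have "A \<subseteq> {x. h x = 0}" using h(2) A False by auto
  moreover have "subspace {x. h x = 0}" using linear_subspace_kernel[OF h(1)] .
  ultimately have hV: "h x = 0" if "x \<in> V" for x
    using that sA span_minimal by blast
  let ?V' = "span (insert e V)"
  have V': "x - h x *\<^sub>R e \<in> V" if "x \<in> ?V'" for x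
  proof -
    obtain k where k: "x - k *\<^sub>R e \<in> V"
      using span_breakdown_eq[of x e V] \<open>x \<in> ?V'\<close> V by (metis span_eq_iff)
    then have "h (x - k *\<^sub>R e) = 0" by (rule hV)
    then have "h x = k" by (simp add: linear_diff[OF h(1)] linear_scale[OF h(1)] he)
    with k show ?thesis by simp
  qed
  have VV': "V \<subseteq> ?V'" by (meson span_superset subset_insertI subset_trans)
  have eV': "e \<in> ?V'" by (simp add: span_base)
  have sub: "subspace ?V'" by simp
  \<comment> \<open>The segment from \<open>x\<close> to \<open>y\<close> crosses \<open>V\<close>,
    and the crossing point is in \<open>S\<close> by convexity.\<close>
  have mix: "((- h y) / (h x - h y)) *\<^sub>R x + (h x / (h x - h y)) *\<^sub>R y \<in> S \<inter> V"
    if "x \<in> S \<inter> ?V'" "y \<in> S \<inter> ?V'" "h x > 0" "h y < 0" for x y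
  proof -
    let ?w = "((- h y) / (h x - h y)) *\<^sub>R x + (h x / (h x - h y)) *\<^sub>R y"
    have D: "h x - h y > 0" using that by simp
    have "(- h y) / (h x - h y) + h x / (h x - h y) = 1"
      using D by (metis add.commute add_divide_distrib diff_conv_add_uminus divide_self less_irrefl)
    then have "?w \<in> S" using that D by (intro convexD[OF S(1)]) (auto simp: divide_nonpos_pos)
    moreover have "?w \<in> ?V'" using that sub by (intro subspace_add subspace_scale) auto
    moreover have "h ?w = 0"
      using that by (simp add: linear_add[OF h(1)] linear_diff[OF h(1)] linear_scale[OF h(1)] field_simps)
    ultimately show ?thesis using V' by fastforce
  qed
  show ?thesis
  proof (cases "S \<inter> V = {}")
    \<comment> \<open>Here \<open>f\<close> carries no information, but within \<open>?V'\<close>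
      the set \<open>S\<close> cannot have points on both sides of \<open>V\<close>, so
      \<open>h\<close> or \<open>- h\<close> is positive on it.\<close>
    case True
    have nz: "h x \<noteq> 0" if "x \<in> S \<inter> ?V'" for x
      using that True V' by fastforce
    show ?thesis
    proof (cases "\<exists>x \<in> S \<inter> ?V'. h x > 0")
      case True
      then have "h y > 0" if "y \<in> S \<inter> ?V'" for y
        using mix nz that \<open>S \<inter> V = {}\<close> by (metis empty_iff linorder_less_linear)
      then show ?thesis using that h(1) by blast
    next
      case False
      then have "- h y > 0" if "y \<in> S \<inter> ?V'" for y
        using nz that by (metis linorder_less_linear neg_0_less_iff_less)
      moreover have "linear (\<lambda>x. - h x)" using h(1) by (rule linear_compose_neg)
      ultimately show ?thesis using that by blast
    qed
  next
    case False
    then obtain y where y: "y \<in> S" "y \<in> V" by blast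
    have fy: "f y > 0" using pos y by blast
    \<comment> \<open>\<open>q x\<close> is the value at \<open>e\<close> for which the extension of
      \<open>f\<close> vanishes at \<open>x\<close>. Positivity at \<open>x\<close> thus means
      \<open>c > q x\<close> on \<open>P\<close> and \<open>c < q x\<close> on
      \<open>N\<close>.\<close>
    define q where "q x = - f (x - h x *\<^sub>R e) / h x" for x
    define P where "P = {x \<in> S \<inter> ?V'. h x > 0}"
    define N where "N = {x \<in> S \<inter> ?V'. h x < 0}"
    have hlin: "h (x + t *\<^sub>R v) = h x + t * h v" for x t v
      by (simp add: linear_add[OF h(1)] linear_scale[OF h(1)])
    obtain e1 where e1: "e1 > 0" "\<And>t. 0 \<le> t \<Longrightarrow> t \<le> e1 \<Longrightarrow> y + t *\<^sub>R e \<in> S"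
      using alg_openD[OF S(2) y(1)] by metis
    obtain e2 where e2: "e2 > 0" "\<And>t. 0 \<le> t \<Longrightarrow> t \<le> e2 \<Longrightarrow> y + t *\<^sub>R (-e) \<in> S"
      using alg_openD[OF S(2) y(1)] by metis
    have "y + e1 *\<^sub>R e \<in> P"
      using e1 y VV' eV' sub unfolding P_def
      by (auto simp: hlin hV he intro!: subspace_add subspace_scale)
    then have Pne: "P \<noteq> {}" by blast
    have "y + e2 *\<^sub>R (-e) \<in> N"
      using e2(1) e2(2)[of e2] y VV' eV' sub hlin[of y "- e2" e] unfolding N_def
      by (auto simp: hV he intro!: subspace_diff subspace_scale)
    then have Nne: "N \<noteq> {}" by blast
    have le: "q x \<le> q z" if "x \<in> P" "z \<in> N" for x z
    proof -
      have hx: "h x > 0" and hz: "h z < 0" using that unfolding P_def N_def by auto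
      let ?w = "((- h z) / (h x - h z)) *\<^sub>R x + (h x / (h x - h z)) *\<^sub>R z"
      have "?w \<in> S \<inter> V" using mix that unfolding P_def N_def by blast
      then have "f ?w > 0" by (rule pos)
      moreover have "f ?w = ((- h z) * f x + h x * f z) / (h x - h z)"
        by (simp only: linear_add[OF f] linear_scale[OF f] real_scaleR_def add_divide_distrib times_divide_eq_left)
      ultimately have "(- h z) * f x + h x * f z > 0"
        using hx hz by (simp add: zero_less_divide_iff)
      then show ?thesis using hx hz unfolding q_def
        by (simp add: linear_diff[OF f] linear_scale[OF f] field_simps)
    qed
    define c where "c = Sup (q ` P)"
    have cP: "q x \<le> c" if "x \<in> P" for x
    proof -
      obtain z where "z \<in> N" using Nne by blast
      then have "bdd_above (q ` P)" using le by (intro bdd_aboveI2[where M = "q z"]) blast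
      then show ?thesis unfolding c_def using that by (intro cSUP_upper)
    qed
    have cN: "c \<le> q x" if "x \<in> N" for x
      unfolding c_def using that le Pne by (intro cSUP_least) auto
    define g where "g x = f x + (c - f e) * h x" for x
    have g: "linear g"
      unfolding g_def using linear_add[OF f] linear_scale[OF f] linear_add[OF h(1)] linear_scale[OF h(1)]
      by (intro linearI) (auto simp: algebra_simps)
    have gq: "g x = h x * (c - q x)" if "h x \<noteq> 0" for x
      using that unfolding g_def q_def by (simp add: linear_diff[OF f] linear_scale[OF f] field_simps)
    have ge: "g x \<ge> 0" if x: "x \<in> S \<inter> ?V'" for x
    proof -
      consider "x \<in> P" | "x \<in> N" | "h x = 0" using x unfolding P_def N_def by fastforce
      then show ?thesis
      proof cases
        case 1 then show ?thesis using cP[of x] gq[of x] unfolding P_def by simp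
      next
        case 2 then show ?thesis using cN[of x] gq[of x] unfolding N_def
          by (auto intro: mult_nonpos_nonpos)
      next
        case 3
        then have "x \<in> V" using V'[of x] that by simp
        then show ?thesis using pos[of x] that 3 unfolding g_def by simp
      qed
    qed
    \<comment> \<open>At a zero \<open>x\<close> of \<open>g\<close>, a small move in direction
      \<open>- y\<close> would stay in \<open>S\<close> and make \<open>g\<close> negative, as
      \<open>g y = f y > 0\<close>.\<close>
    have "g x > 0" if x: "x \<in> S \<inter> ?V'" for x
    proof (rule ccontr)
      assume "\<not> 0 < g x"
      then have g0: "g x = 0" using ge[OF x] by simp
      obtain d where d: "d > 0" "\<And>t. 0 \<le> t \<Longrightarrow> t \<le> d \<Longrightarrow> x + t *\<^sub>R (-y) \<in> S"
        using S(2) x by (metis IntD1 alg_openD)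
      have "x + d *\<^sub>R (-y) \<in> S \<inter> ?V'"
        using d(1) d(2)[of d] x y VV' sub by (auto intro!: subspace_diff subspace_scale)
      from ge[OF this] have "0 \<le> - d * f y"
        using g0 hV[OF y(2)] by (simp add: linear_diff[OF g] linear_scale[OF g]) (simp add: g_def)
      then show False using d(1) fy by (simp add: mult_le_0_iff)
    qed
    then show ?thesis using that g by blast
  qed
qed

text \<open>On \<open>L\<close> the zero functional is vacuously positive, because \<open>S\<close>
  misses \<open>L\<close>; each element of \<open>F\<close> then costs one extension step.\<close>

lemma positive_functional:
  fixes S :: "'a::real_vector set"
  assumes S: "convex S" "alg_open S" and L: "subspace L" "S \<inter> L = {}"
    and F: "finite F" "span (L \<union> F) = UNIV"
  obtains g where "linear g" "\<And>x. x \<in> S \<Longrightarrow> (g x :: real) > 0"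
proof -
  have "\<exists>g. linear g \<and> (\<forall>x \<in> S \<inter> span (L \<union> F). (g x :: real) > 0)"
    using F(1)
  proof (induction F)
    case empty
    have "span (L \<union> {}) = L" using L(1) by (simp add: span_eq_iff)
    then show ?case using L(2) linear_zero by fastforce
  next
    case (insert e F)
    then obtain f where f: "linear f" "\<And>x. x \<in> S \<inter> span (L \<union> F) \<Longrightarrow> (f x :: real) > 0" by blast
    obtain g where g: "linear g" "\<And>x. x \<in> S \<inter> span (insert e (span (L \<union> F))) \<Longrightarrow> (g x :: real) > 0"
      using extend_positive_functional[OF S subspace_span f] by blast
    have "span (L \<union> insert e F) \<subseteq> span (insert e (span (L \<union> F)))"
      by (rule span_mono) (use span_superset[of "L \<union> F"] in auto)
    then show ?case using g by blast
  qed
  then show ?thesis using F(2) that by auto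
qed

text \<open>The reflected set of all \<open>z - x\<close> with \<open>x \<in> S\<close> misses
  \<open>L\<close>, since \<open>S\<close> is invariant under \<open>L\<close> and does not contain
  \<open>z\<close>.\<close>

lemma separate_point:
  fixes S :: "'a::real_vector set"
  assumes S: "convex S" "alg_open S" "invariant_under L S" "z \<notin> S" and L: "subspace L"
    and F: "finite F" "span (L \<union> F) = UNIV"
  obtains g where "linear g" "\<And>x. x \<in> S \<Longrightarrow> (g x :: real) < g z"
proof -
  have lin: "linear (\<lambda>x::'a. - x)" by (intro linearI) auto
  let ?S = "{x. z + - x \<in> S}"
  have "?S \<inter> L = {}"
  proof -
    have "False" if "z + - l \<in> S" "l \<in> L" for l
    proof -
      have "(z + - l) + l \<in> S" using S(3) that unfolding invariant_under_def by blast
      then show False using S(4) by simp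
    qed
    then show ?thesis by blast
  qed
  then obtain g where g: "linear g" "\<And>x. x \<in> ?S \<Longrightarrow> (g x :: real) > 0"
    using positive_functional[OF convex_affine_vimage[OF S(1) lin] alg_open_affine_vimage[OF S(2) lin] L _ F]
    by metis
  have "g x < g z" if "x \<in> S" for x
    using g(2)[of "z - x"] that by (simp add: linear_diff[OF g(1)])
  then show ?thesis using that g(1) by blast
qed

section \<open>Boundary points of a convex set, reached along segments\<close>

text \<open>Here \<open>z\<close> acts as a closure point of \<open>S\<close>. The target is a
  convex combination of \<open>z\<close> pushed by \<open>y\<close> towards \<open>u\<close> and of
  \<open>p\<close> pushed by \<open>x\<close> the opposite way; the choice
  \<open>(1 - e) * y = e * x\<close> makes the pushes cancel.\<close>

lemma accessible_point:
  assumes S: "convex S" "alg_open S" and p: "p \<in> S"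
    and acc: "\<And>t. 0 < t \<Longrightarrow> t \<le> 1 \<Longrightarrow> z + t *\<^sub>R (u - z) \<in> S" and e: "0 < e" "e \<le> 1"
  shows "z + e *\<^sub>R (p - z) \<in> S"
proof (cases "e = 1")
  case True
  then show ?thesis using p by simp
next
  case False
  then have e1: "e < 1" using e by simp
  obtain d where d: "d > 0" "\<And>t. 0 \<le> t \<Longrightarrow> t \<le> d \<Longrightarrow> p + t *\<^sub>R (z - u) \<in> S"
    using alg_openD[OF S(2) p, of "z - u"] by blast
  define x where "x = min d ((1 - e) / e)"
  define y where "y = e * x / (1 - e)"
  have x: "0 < x" "x \<le> d" "x \<le> (1 - e) / e" using d e e1 unfolding x_def by auto
  have y: "0 < y" "y \<le> 1" "(1 - e) * y = e * x"
    using x e e1 unfolding y_def by (auto simp: field_simps)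
  have "(1 - e) *\<^sub>R (z + y *\<^sub>R (u - z)) + e *\<^sub>R (p + x *\<^sub>R (z - u)) \<in> S"
    using x y e e1 d acc by (intro convexD[OF S(1)]) auto
  moreover have "(1 - e) *\<^sub>R (z + y *\<^sub>R (u - z)) + e *\<^sub>R (p + x *\<^sub>R (z - u))
      = (1 - e) *\<^sub>R z + ((1 - e) * y) *\<^sub>R (u - z) + e *\<^sub>R p + (e * x) *\<^sub>R (z - u)"
    by (simp add: scaleR_add_right)
  also have "\<dots> = z + e *\<^sub>R (p - z)" unfolding y(3) by (simp add: algebra_simps)
  ultimately show ?thesis by simp
qed


text \<open>Openness along single lines becomes joint openness in finitely many directions: the
  perturbed point is the average of points of \<open>W\<close> that are each moved along one
  direction only.\<close>

lemma small_combination_mem: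
  assumes W: "convex W" "alg_open W" "u \<in> W" and X: "finite X"
  obtains e where "e > 0" "\<And>c. (\<And>v. v \<in> X \<Longrightarrow> \<bar>c v\<bar> \<le> e) \<Longrightarrow> u + (\<Sum>v\<in>X. c v *\<^sub>R v) \<in> W"
proof (cases "X = {}")
  case True
  then show ?thesis using that[of 1] W(3) by simp
next
  case False
  then have N: "real (card X) > 0" using X by (simp add: card_gt_0_iff)
  have "\<exists>e>0. \<forall>t. \<bar>t\<bar> \<le> e \<longrightarrow> u + t *\<^sub>R v \<in> W" for v
  proof -
    obtain e1 where e1: "e1 > 0" "\<And>t. 0 \<le> t \<Longrightarrow> t \<le> e1 \<Longrightarrow> u + t *\<^sub>R v \<in> W"
      using alg_openD[OF W(2,3)] by metis
    obtain e2 where e2: "e2 > 0" "\<And>t. 0 \<le> t \<Longrightarrow> t \<le> e2 \<Longrightarrow> u + t *\<^sub>R (- v) \<in> W"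
      using alg_openD[OF W(2,3), of "-v"] by metis
    have "u + t *\<^sub>R v \<in> W" if "\<bar>t\<bar> \<le> min e1 e2" for t
      using that e1(2)[of t] e2(2)[of "- t"] by (cases "t \<ge> 0") auto
    then show ?thesis using e1(1) e2(1) by (intro exI[of _ "min e1 e2"]) auto
  qed
  then obtain d where d: "\<And>v. d v > 0" "\<And>v t. \<bar>t\<bar> \<le> d v \<Longrightarrow> u + t *\<^sub>R v \<in> W"
    by metis
  define e where "e = Min (d ` X) / card X"
  have "Min (d ` X) > 0" using d(1) X False by simp
  then have "e > 0" unfolding e_def using N by simp
  moreover have "u + (\<Sum>v\<in>X. c v *\<^sub>R v) \<in> W" if c: "\<And>v. v \<in> X \<Longrightarrow> \<bar>c v\<bar> \<le> e" for c
  proof -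
    have "(\<Sum>v\<in>X. (1 / card X) *\<^sub>R (u + (card X * c v) *\<^sub>R v)) \<in> W"
    proof (rule convex_sum[OF X W(1)])
      fix v assume v: "v \<in> X"
      have "\<bar>card X * c v\<bar> \<le> card X * e" using c[OF v] by (simp add: abs_mult mult_left_mono)
      also have "\<dots> = Min (d ` X)" unfolding e_def using N by simp
      also have "\<dots> \<le> d v" using v X by simp
      finally show "u + (card X * c v) *\<^sub>R v \<in> W" by (rule d(2))
    qed (use N in auto)
    moreover have "(\<Sum>v\<in>X. (1 / card X) *\<^sub>R (u + (card X * c v) *\<^sub>R v)) = u + (\<Sum>v\<in>X. c v *\<^sub>R v)"
      using N by (simp add: scaleR_add_right sum.distrib sum_constant_scaleR)
    ultimately show ?thesis by simp
  qed
  ultimately show ?thesis by (rule that)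
qed

text \<open>The hull is shrunk towards \<open>u\<close>, and \<open>s\<close> is the supremum of the
  factors for which the image still meets \<open>W\<close>. The contact point comes from a limit of
  convex coefficients, so that only compactness in finitely many real coordinates is used.\<close>

lemma first_contact:
  fixes W :: "'a::real_vector set"
  assumes W: "convex W" "alg_open W" "u \<in> W" and X: "finite X" "X \<noteq> {}"
    and disj: "convex hull X \<inter> W = {}"
  obtains s q where "0 < s" "s \<le> 1" "q \<in> convex hull X"
    "\<And>t. 0 \<le> t \<Longrightarrow> t < s \<Longrightarrow> u + t *\<^sub>R (q - u) \<in> W"
    "\<And>q'. q' \<in> convex hull X \<Longrightarrow> u + s *\<^sub>R (q' - u) \<notin> W"
proof -
  let ?Q = "convex hull X"
  define T where "T = {t. 0 \<le> t \<and> t \<le> 1 \<and> (\<exists>q\<in>?Q. u + t *\<^sub>R (q - u) \<in> W)}"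
  define s where "s = Sup T"
  obtain x0 where x0: "x0 \<in> ?Q" using X(2) hull_inc by (metis all_not_in_conv)
  have T0: "0 \<in> T" unfolding T_def using W(3) x0 by auto
  have T1: "t \<le> 1" if "t \<in> T" for t using that unfolding T_def by simp
  have bdd: "bdd_above T" unfolding T_def by (auto intro: bdd_aboveI)
  have sT: "t \<le> s" if "t \<in> T" for t unfolding s_def using that bdd by (rule cSup_upper)
  have s1: "s \<le> 1" unfolding s_def using T0 by (intro cSup_least[OF _ T1]) blast
  have down: "u + t' *\<^sub>R (q - u) \<in> W" if "u + t *\<^sub>R (q - u) \<in> W" "0 \<le> t'" "t' \<le> t" for t t' q
  proof (cases "t = 0")
    case True
    then show ?thesis using that by simp
  next
    case False
    then have t: "t > 0" using that by simp
    have "(1 - t' / t) *\<^sub>R u + (t' / t) *\<^sub>R (u + t *\<^sub>R (q - u)) \<in> W"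
      using that t W by (intro convexD[OF W(1)]) auto
    moreover have "(1 - t' / t) *\<^sub>R u + (t' / t) *\<^sub>R (u + t *\<^sub>R (q - u)) = u + t' *\<^sub>R (q - u)"
      using t by (simp add: scaleR_add_right scaleR_left_diff_distrib)
    ultimately show ?thesis by simp
  qed
  have s0: "s > 0"
  proof -
    obtain e where e: "e > 0" "\<And>t. 0 \<le> t \<Longrightarrow> t \<le> e \<Longrightarrow> u + t *\<^sub>R (x0 - u) \<in> W"
      using alg_openD[OF W(2,3)] by metis
    then have "u + min e 1 *\<^sub>R (x0 - u) \<in> W" by simp
    then have "min e 1 \<in> T" unfolding T_def using x0 e(1) by auto
    then show ?thesis using sT e(1) by fastforce
  qed
  \<comment> \<open>The supremum is not attained: for \<open>s = 1\<close> by disjointness, and for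
    \<open>s < 1\<close> because openness would allow a larger factor.\<close>
  have miss: "u + s *\<^sub>R (q - u) \<notin> W" if q: "q \<in> ?Q" for q
  proof
    assume *: "u + s *\<^sub>R (q - u) \<in> W"
    have "s \<noteq> 1" using * q disj by auto
    then have "s < 1" using s1 by simp
    obtain e where e: "e > 0" "\<And>t. 0 \<le> t \<Longrightarrow> t \<le> e \<Longrightarrow> (u + s *\<^sub>R (q - u)) + t *\<^sub>R (q - u) \<in> W"
      using alg_openD[OF W(2) *] by metis
    define t where "t = min e (1 - s)"
    have t: "0 < t" "t \<le> e" "s + t \<le> 1" using e \<open>s < 1\<close> unfolding t_def by auto
    have "u + (s + t) *\<^sub>R (q - u) \<in> W" using e(2)[of t] t by (simp add: algebra_simps)
    then have "s + t \<in> T" unfolding T_def using t s0 q by auto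
    then show False using sT t by fastforce
  qed
  have "\<exists>t q. t \<in> T \<and> s - 1 / Suc n < t \<and> q \<in> ?Q \<and> u + t *\<^sub>R (q - u) \<in> W" for n :: nat
  proof -
    have "s - 1 / Suc n < Sup T" unfolding s_def by simp
    then obtain t where "t \<in> T" "s - 1 / Suc n < t" using T0 less_cSupD by blast
    then show ?thesis unfolding T_def by blast
  qed
  then obtain \<tau> q where tq: "\<And>n::nat. \<tau> n \<in> T" "\<And>n::nat. s - 1 / Suc n < \<tau> n" "\<And>n::nat. q n \<in> ?Q"
      "\<And>n::nat. u + \<tau> n *\<^sub>R (q n - u) \<in> W"
    by metis
  have "\<exists>c. (\<forall>x\<in>X. 0 \<le> c x) \<and> sum c X = 1 \<and> (\<Sum>x\<in>X. c x *\<^sub>R x) = q n" for n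
    using tq(3)[of n] convex_hull_finite[OF X(1)] by blast
  then obtain c where c: "\<And>n x. x \<in> X \<Longrightarrow> 0 \<le> c n x" "\<And>n. sum (c n) X = 1"
      "\<And>n. (\<Sum>x\<in>X. c n x *\<^sub>R x) = q n"
    by metis
  have c1: "c n x \<le> 1" if "x \<in> X" for n x
    using member_le_sum[OF that _ X(1), of "c n"] c by auto
  \<comment> \<open>Bolzano-Weierstrass for the coefficient vectors, whose coordinates all lie
    between 0 and 1.\<close>
  have "\<forall>D\<subseteq>X. \<exists>l. \<exists>r::nat\<Rightarrow>nat. strict_mono r \<and>
      (\<forall>e>0. eventually (\<lambda>n. \<forall>i\<in>D. dist (c (r n) i) (l i) < e) sequentially)"
  proof (rule compact_lemma_general[where unproj = "\<lambda>f. f" and proj = "\<lambda>f. f"])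
    fix k assume "k \<in> X"
    then show "bounded ((\<lambda>f. f k) ` range c)"
      by (intro boundedI[of _ 1]) (use c(1) c1 in auto)
  qed (use X in auto)
  then obtain l r where r: "strict_mono (r :: nat \<Rightarrow> nat)"
      "\<And>e. e > 0 \<Longrightarrow> eventually (\<lambda>n. \<forall>i\<in>X. dist (c (r n) i) (l i) < e) sequentially"
    by blast
  have lim: "(\<lambda>n. c (r n) x) \<longlonglongrightarrow> l x" if "x \<in> X" for x
  proof (rule tendstoI)
    fix e :: real assume "e > 0"
    show "\<forall>\<^sub>F n in sequentially. dist (c (r n) x) (l x) < e"
      using r(2)[OF \<open>e > 0\<close>] by (rule eventually_mono) (use that in blast)
  qed
  have l0: "0 \<le> l x" if "x \<in> X" for x
    using lim[OF that] by (rule LIMSEQ_le_const) (use c(1) that in auto)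
  have "(\<lambda>n. sum (c (r n)) X) \<longlonglongrightarrow> sum l X" by (rule tendsto_sum) (rule lim)
  then have l1: "sum l X = 1" using c(2) by (simp add: LIMSEQ_const_iff)
  define z where "z = (\<Sum>x\<in>X. l x *\<^sub>R x)"
  have zQ: "z \<in> ?Q" unfolding z_def convex_hull_finite[OF X(1)] using l0 l1 by blast
  have "u + t *\<^sub>R (z - u) \<in> W" if t: "0 \<le> t" "t < s" for t
  proof -
    \<comment> \<open>The intermediate \<open>t'\<close> leaves room to replace
      \<open>q (r n)\<close> by the limit \<open>z\<close>. The target is a combination, with
      weights \<open>t / t'\<close> and \<open>1 - t / t'\<close>, of a point of \<open>W\<close>
      towards \<open>q (r n)\<close> and of a small perturbation of \<open>u\<close>;
      \<open>k\<close> is scaled so that the latter corrects the error.\<close>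
    define t' where "t' = (t + s) / 2"
    have t': "t < t'" "t' < s" "0 < t'" using t s0 unfolding t'_def by auto
    define k where "k = t / (1 - t / t')"
    have k: "0 \<le> k" "(1 - t / t') * k = t" using t t' unfolding k_def by (auto simp: field_simps)
    obtain e where e: "e > 0" "\<And>c. (\<And>v. v \<in> X \<Longrightarrow> \<bar>c v\<bar> \<le> e) \<Longrightarrow> u + (\<Sum>v\<in>X. c v *\<^sub>R v) \<in> W"
      using small_combination_mem[OF W X(1)] by blast
    have "\<forall>\<^sub>F n in sequentially. 1 / Suc n < s - t'"
      using order_tendstoD(2)[OF LIMSEQ_Suc[OF lim_inverse_n'], of "s - t'"] t' by simp
    then have "\<forall>\<^sub>F n in sequentially. 1 / Suc (r n) < s - t'"
      by (rule eventually_compose_filterlim[OF _ filterlim_subseq[OF r(1)]])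
    moreover have "\<forall>\<^sub>F n in sequentially. \<forall>i\<in>X. dist (c (r n) i) (l i) < e / (k + 1)"
      using r(2) e(1) k(1) by simp
    ultimately have "\<forall>\<^sub>F n in sequentially. 1 / Suc (r n) < s - t' \<and> (\<forall>i\<in>X. dist (c (r n) i) (l i) < e / (k + 1))"
      by (rule eventually_conj)
    then obtain n where n: "1 / Suc (r n) < s - t'" "\<forall>i\<in>X. dist (c (r n) i) (l i) < e / (k + 1)"
      using eventually_happens'[OF sequentially_bot] by blast
    let ?q = "q (r n)"
    have "t' \<le> \<tau> (r n)" using n(1) tq(2)[of "r n"] by simp
    then have "u + t' *\<^sub>R (?q - u) \<in> W" using down tq(4) t'(3) by (metis less_imp_le)
    moreover have "u + (\<Sum>x\<in>X. (k * (l x - c (r n) x)) *\<^sub>R x) \<in> W"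
    proof (rule e(2))
      fix x assume "x \<in> X"
      then have "\<bar>l x - c (r n) x\<bar> \<le> e / (k + 1)" using n(2) by (auto simp: dist_real_def)
      then have "k * \<bar>l x - c (r n) x\<bar> \<le> k * (e / (k + 1))" using k(1) by (rule mult_left_mono)
      also have "\<dots> \<le> e" using k(1) e(1) by (simp add: field_simps)
      finally show "\<bar>k * (l x - c (r n) x)\<bar> \<le> e" using k(1) by (simp add: abs_mult)
    qed
    moreover have "(\<Sum>x\<in>X. (k * (l x - c (r n) x)) *\<^sub>R x) = k *\<^sub>R (z - ?q)"
      unfolding z_def c(3)[symmetric]
      by (simp add: scaleR_right.sum sum_subtractf[symmetric] algebra_simps)
    ultimately have "(t / t') *\<^sub>R (u + t' *\<^sub>R (?q - u)) + (1 - t / t') *\<^sub>R (u + k *\<^sub>R (z - ?q)) \<in> W"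
      using t t' by (intro convexD[OF W(1)]) auto
    moreover have "(t / t') *\<^sub>R (u + t' *\<^sub>R (?q - u)) + (1 - t / t') *\<^sub>R (u + k *\<^sub>R (z - ?q))
        = (t / t') *\<^sub>R u + (t / t' * t') *\<^sub>R (?q - u) + (1 - t / t') *\<^sub>R u + ((1 - t / t') * k) *\<^sub>R (z - ?q)"
      by (simp add: scaleR_add_right)
    also have "\<dots> = u + t *\<^sub>R (z - u)"
      unfolding k(2) using t' by (simp add: algebra_simps)
    ultimately show ?thesis by simp
  qed
  then show ?thesis using that s0 s1 zQ miss by blast
qed


section \<open>The sunflower theorem\<close>

lemma convex_linear_level:
  fixes g :: "'a::real_vector \<Rightarrow> real"
  assumes "linear g"
  shows "convex {x. g x < c}" "convex {x. g x = c}" "convex {x. g x \<ge> c}"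
  using convex_linear_vimage[OF assms convex_real_interval(4), of c]
    convex_linear_vimage[OF assms convex_singleton, of c]
    convex_linear_vimage[OF assms convex_real_interval(1), of c]
  by (simp_all add: vimage_def)

lemma convex_line_point:
  assumes "convex S" "x \<in> S" "y \<in> S" "0 \<le> t" "t \<le> 1"
  shows "x + t *\<^sub>R (y - x) \<in> S"
  using convexD[OF assms(1-3), of "1 - t" t] assms(4,5) by (simp add: algebra_simps)

text \<open>\<open>card B\<close> bounds the dimension modulo \<open>L\<close>. In the induction one
  vector \<open>c\<close> passes from \<open>B\<close> to \<open>L\<close> and one petal
  \<open>i0\<close> is given up; the sets and points change too, so all of them are
  generalized.\<close>

lemma sunflower_meets_center:
  fixes U :: "'i \<Rightarrow> 'a::real_vector set"
  assumes "finite B" "span (L \<union> B) = UNIV" "subspace L" "finite I" "card B < card I"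
    and "convex W" "alg_open W" "invariant_under L W" "W \<noteq> {}"
    and "\<And>i. i \<in> I \<Longrightarrow> convex (U i)" "\<And>i. i \<in> I \<Longrightarrow> alg_open (U i)"
    and "\<And>i. i \<in> I \<Longrightarrow> invariant_under L (U i)" "\<And>i. i \<in> I \<Longrightarrow> W \<subseteq> U i"
    and "\<And>i j. i \<in> I \<Longrightarrow> j \<in> I \<Longrightarrow> i \<noteq> j \<Longrightarrow> U i \<inter> U j \<subseteq> W"
    and "\<And>i. i \<in> I \<Longrightarrow> p i \<in> U i"
  shows "convex hull (p ` I) \<inter> W \<noteq> {}"
  using assms
proof (induction "card B" arbitrary: B L I U W p rule: less_induct)
  case less
  note B = less.prems(1,2) and L = less.prems(3) and I = less.prems(4,5) and W = less.prems(6-9)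
    and U = less.prems(10-13) and meet = less.prems(14) and p = less.prems(15)
  obtain u where u: "u \<in> W" using W(4) by blast
  obtain i0 where i0: "i0 \<in> I" using I(2) by fastforce
  show ?case
  proof (cases "B = {}")
    \<comment> \<open>In codimension 0 a nonempty invariant set is the whole space.\<close>
    case True
    then have "L = UNIV" using B(2) L by (metis span_eq_iff sup_bot_right)
    have "u + (p i0 - u) \<in> W"
      using u W(3) \<open>L = UNIV\<close> unfolding invariant_under_def by blast
    then show ?thesis using i0 hull_inc[of "p i0" "p ` I" convex] by auto
  next
    case False
    then have cB: "card B > 0" using B(1) by (simp add: card_gt_0_iff)
    define J where "J = I - {i0}"
    have J: "finite J" "card J = card I - 1" "J \<subseteq> I" using I(1) i0 unfolding J_def by auto
    have "J \<noteq> {}" using J(2) I(2) cB by auto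
    show ?thesis
    proof (rule ccontr)
      assume "\<not> ?thesis"
      then have disj: "convex hull (p ` I) \<inter> W = {}" by blast
      obtain s q where s: "0 < s" "s \<le> 1" and q: "q \<in> convex hull (p ` I)"
        and before: "\<And>t. 0 \<le> t \<Longrightarrow> t < s \<Longrightarrow> u + t *\<^sub>R (q - u) \<in> W"
        and at: "\<And>q'. q' \<in> convex hull (p ` I) \<Longrightarrow> u + s *\<^sub>R (q' - u) \<notin> W"
        using first_contact[OF W(1,2) u _ _ disj] I(1) i0 by blast
      \<comment> \<open>\<open>h\<close> is the homothety with centre \<open>u\<close> and factor
        \<open>s\<close>. The shrunk hull \<open>C\<close> misses \<open>W\<close>, while its point
        \<open>z\<close> is a limit of points of \<open>W\<close> on the segment from
        \<open>u\<close>.\<close>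
      define h where "h x = (1 - s) *\<^sub>R u + s *\<^sub>R x" for x
      have h: "h x = u + s *\<^sub>R (x - u)" for x unfolding h_def by (simp add: algebra_simps)
      define C where "C = h ` (convex hull (p ` I))"
      have cC: "convex C" unfolding C_def h_def by (intro convex_affinity) simp
      have CW: "C \<inter> W = {}" using at unfolding C_def h by blast
      define z where "z = h q"
      have zC: "z \<in> C" unfolding z_def C_def using q by blast
      define p' where "p' i = h (p i)" for i
      have p'C: "p' i \<in> C" if "i \<in> I" for i
        unfolding p'_def C_def using that by (intro imageI hull_inc) auto
      have p'U: "p' i \<in> U i" if "i \<in> I" for i
        unfolding p'_def h using U(4)[OF that] u s
          by (intro convex_line_point[OF U(1)[OF that] _ p[OF that]]) auto
      have acc: "z + t *\<^sub>R (u - z) \<in> W" if "0 < t" "t \<le> 1" for t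
      proof -
        have "u + (s * (1 - t)) *\<^sub>R (q - u) \<in> W"
          using that s by (intro before) auto
        then show ?thesis unfolding z_def h by (simp add: algebra_simps)
      qed
      \<comment> \<open>Since \<open>W\<close> lies in every petal, \<open>z\<close> is accessible
        from every petal as well.\<close>
      have reach: "z + t *\<^sub>R (v - z) \<in> U i" if "i \<in> I" "v \<in> U i" "0 < t" "t \<le> 1" for i t v
        by (rule accessible_point[OF U(1)[OF that(1)] U(2)[OF that(1)] that(2) _ that(3,4), of z u])
          (use U(4)[OF that(1)] acc in blast)
      define K where "K = convex hull (\<Union>j\<in>J. U j)"
      have UK: "U j \<subseteq> K" if "j \<in> J" for j
        unfolding K_def using that hull_subset[of "\<Union>j\<in>J. U j" convex] by blast
      have WK: "W \<subseteq> K" using UK U(4) J(3) \<open>J \<noteq> {}\<close> by blast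
      have cK: "convex K" unfolding K_def by simp
      have aK: "alg_open K"
        unfolding K_def using U(2) J(3) by (intro alg_open_convex_hull alg_open_UN) blast
      have iK: "invariant_under L K"
        unfolding K_def using U(3) J(3) by (intro invariant_under_convex_hull invariant_under_UN) blast
      \<comment> \<open>If \<open>z\<close> were in \<open>K\<close>, a small step towards
        \<open>p' i0\<close> would stay in \<open>K\<close> and enter \<open>U i0\<close>, at a
        point \<open>y\<close> of \<open>C\<close> and thus outside \<open>W\<close>. The segment
        from \<open>u\<close> to \<open>y\<close> leaves \<open>W\<close> at some \<open>r\<close>,
        which lies in both \<open>K\<close> and \<open>U i0\<close>; a hyperplane supporting
        \<open>W\<close> there leads to a contradiction.\<close>
      have zK: "z \<notin> K"
      proof
        assume "z \<in> K"
        then obtain e0 where e0: "e0 > 0" "\<And>t. 0 \<le> t \<Longrightarrow> t \<le> e0 \<Longrightarrow> z + t *\<^sub>R (p' i0 - z) \<in> K"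
          using alg_openD[OF aK] by metis
        define e where "e = min e0 1"
        have e: "0 < e" "e \<le> e0" "e \<le> 1" using e0 unfolding e_def by auto
        define y where "y = z + e *\<^sub>R (p' i0 - z)"
        have yK: "y \<in> K" unfolding y_def using e by (intro e0(2)) auto
        have yU: "y \<in> U i0"
          unfolding y_def by (rule reach[OF i0 p'U[OF i0] e(1,3)])
        have "y \<in> C" unfolding y_def using e by (intro convex_line_point[OF cC zC p'C[OF i0]]) auto
        then have "convex hull {y} \<inter> W = {}" using CW by auto
        then obtain t0 where t0: "0 < t0" "t0 \<le> 1" "u + t0 *\<^sub>R (y - u) \<notin> W"
          "\<And>t. 0 \<le> t \<Longrightarrow> t < t0 \<Longrightarrow> u + t *\<^sub>R (y - u) \<in> W"
          using first_contact[OF W(1,2) u, of "{y}"] by auto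
        define r where "r = u + t0 *\<^sub>R (y - u)"
        have rK: "r \<in> K" unfolding r_def using WK u t0(1,2) by (intro convex_line_point[OF cK _ yK]) auto
        have rU: "r \<in> U i0" unfolding r_def using U(4)[OF i0] u t0(1,2)
          by (intro convex_line_point[OF U(1)[OF i0] _ yU]) auto
        have racc: "r + t *\<^sub>R (u - r) \<in> W" if "0 < t" "t \<le> 1" for t
        proof -
          have "u + (t0 * (1 - t)) *\<^sub>R (y - u) \<in> W"
            using that t0(1) by (intro t0(4)) auto
          then show ?thesis unfolding r_def by (simp add: algebra_simps)
        qed
        have "r \<notin> W" unfolding r_def by (rule t0(3))
        then obtain g where g: "linear g" "\<And>x. x \<in> W \<Longrightarrow> (g x :: real) < g r"
          using separate_point[OF W(1-3) _ L B] by metis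
        \<comment> \<open>Near \<open>r \<in> U i0\<close> the petal \<open>U j\<close> coincides with \<open>W\<close>, so a hyperplane supporting
          \<open>W\<close> at \<open>r\<close> supports \<open>U j\<close> as well.\<close>
        have "U j \<subseteq> {x. g x < g r}" if j: "j \<in> J" for j
        proof clarify
          fix x assume x: "x \<in> U j"
          obtain d where d: "d > 0" "\<And>t. 0 \<le> t \<Longrightarrow> t \<le> d \<Longrightarrow> r + t *\<^sub>R (x - r) \<in> U i0"
            using alg_openD[OF U(2)[OF i0] rU] by metis
          define t where "t = min d 1"
          have t: "0 < t" "t \<le> d" "t \<le> 1" using d(1) unfolding t_def by auto
          have jI: "j \<in> I" "i0 \<noteq> j" using j unfolding J_def by auto
          have "r + t *\<^sub>R (x - r) \<in> U j"
            by (rule accessible_point[OF U(1)[OF jI(1)] U(2)[OF jI(1)] x _ t(1,3), of r u])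
              (use U(4)[OF jI(1)] racc in blast)
          moreover have "r + t *\<^sub>R (x - r) \<in> U i0" using d(2) t by simp
          ultimately have "r + t *\<^sub>R (x - r) \<in> W" using meet[OF i0 jI] by blast
          from g(2)[OF this] have "t * (g x - g r) < 0"
            by (simp add: linear_add[OF g(1)] linear_scale[OF g(1)] linear_diff[OF g(1)])
          then show "g x < g r" using t(1) by (simp add: mult_less_0_iff)
        qed
        then have "K \<subseteq> {x. g x < g r}"
          unfolding K_def by (intro hull_minimal convex_linear_level g(1)) auto
        then show False using rK by auto
      qed
      obtain g where g: "linear g" "\<And>x. x \<in> K \<Longrightarrow> (g x :: real) < g z"
        using separate_point[OF cK aK iK zK L B] by metis
      have gl: "g (x + t *\<^sub>R y) = g x + t * g y" for x y t
        by (simp add: linear_add[OF g(1)] linear_scale[OF g(1)])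
      \<comment> \<open>A linear functional bounded above on a nonempty set invariant under
        \<open>L\<close> vanishes on \<open>L\<close>.\<close>
      have gL: "g l = 0" if l: "l \<in> L" for l
      proof (rule ccontr)
        assume "g l \<noteq> 0"
        let ?t = "(g z - g u) / g l"
        have "u + ?t *\<^sub>R l \<in> K"
          using iK WK u l L by (auto simp: invariant_under_def subspace_scale)
        from g(2)[OF this] show False unfolding gl using \<open>g l \<noteq> 0\<close> by simp
      qed
      have "\<exists>c\<in>B. g c \<noteq> 0"
      proof (rule ccontr)
        assume "\<not> ?thesis"
        then have "L \<union> B \<subseteq> {x. g x = 0}" using gL by auto
        then have "span (L \<union> B) \<subseteq> {x. g x = 0}"
          by (rule span_minimal) (rule linear_subspace_kernel[OF g(1)])
        then have "g u = 0" "g z = 0" using B(2) by auto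
        then show False using g(2)[of u] u WK by auto
      qed
      then obtain c where c: "c \<in> B" "g c \<noteq> 0" by blast
      \<comment> \<open>The level \<open>g z - \<delta>\<close> is close enough to \<open>z\<close>
        to be crossed by the segments from \<open>z\<close> to \<open>u\<close> and to every
        \<open>p' j\<close>, and \<open>m v\<close> is the crossing point. Taking \<open>u\<close>
        into account keeps the slice of \<open>W\<close> nonempty.\<close>
      define \<delta> where "\<delta> = Min (insert (g z - g u) ((\<lambda>j. g z - g (p' j)) ` J))"
      have "0 < g z - g (p' j)" if "j \<in> J" for j
        using g(2)[of "p' j"] p'U UK that J(3) by auto
      then have \<delta>: "0 < \<delta>" "\<delta> \<le> g z - g u" "\<And>j. j \<in> J \<Longrightarrow> \<delta> \<le> g z - g (p' j)"
        unfolding \<delta>_def using J(1) g(2)[of u] u WK by auto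
      define e where "e v = \<delta> / (g z - g v)" for v
      define m where "m v = z + e v *\<^sub>R (v - z)" for v
      have e: "0 < e v" "e v \<le> 1" "g (m v) = g z - \<delta>" if "\<delta> \<le> g z - g v" for v
        using that \<delta>(1) unfolding m_def gl unfolding e_def by (auto simp: linear_diff[OF g(1)] field_simps)
      \<comment> \<open>\<open>x \<mapsto> a + f x\<close> projects along \<open>c\<close> onto the hyperplane \<open>g = g z - \<delta>\<close>.\<close>
      define a where "a = ((g z - \<delta>) / g c) *\<^sub>R c"
      define f where "f x = x - (g x / g c) *\<^sub>R c" for x
      have f: "linear f"
        unfolding f_def using linear_add[OF g(1)] linear_scale[OF g(1)]
        by (intro linearI) (auto simp: algebra_simps add_divide_distrib)
      have fix_slice: "a + f x = x" if "g x = g z - \<delta>" for x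
        unfolding a_def f_def that by simp
      let ?L = "span (insert c L)"
      have fL: "f l \<in> L" if l: "l \<in> ?L" for l
      proof -
        obtain k where k: "l - k *\<^sub>R c \<in> L"
          using span_breakdown_eq[of l c L] l L by (metis span_eq_iff)
        then have "g l = k * g c" using gL[OF k] gl[of l "- k" c] by simp
        then have "f l = l - k *\<^sub>R c" unfolding f_def using c(2) by simp
        with k show ?thesis by simp
      qed
      have inv: "invariant_under ?L {x. a + f x \<in> S}" if "invariant_under L S" for S
        unfolding invariant_under_def
      proof clarify
        fix x l assume "a + f x \<in> S" "l \<in> ?L"
        then have "(a + f x) + f l \<in> S"
          using that fL unfolding invariant_under_def by blast
        then show "a + f (x + l) \<in> S" by (simp add: linear_add[OF f] add.assoc)
      qed
      have mW: "m u \<in> W" unfolding m_def using acc e \<delta>(2) by auto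
      have mU: "m (p' j) \<in> U j" if "j \<in> J" for j
        unfolding m_def using that J(3) p'U e(1,2) \<delta>(3) by (intro reach) auto
      have mC: "m (p' j) \<in> C" if "j \<in> J" for j
        unfolding m_def using that J(3) p'C e(1,2) \<delta>(3)
        by (intro convex_line_point[OF cC zC]) (auto intro: less_imp_le)
      have gm: "g (m (p' j)) = g z - \<delta>" if "j \<in> J" for j using e \<delta>(3) that by blast
      have "convex hull ((\<lambda>j. m (p' j)) ` J) \<inter> {x. a + f x \<in> W} \<noteq> {}"
      proof (rule less.hyps[of "B - {c}" ?L J _ "\<lambda>j. {x. a + f x \<in> U j}"])
        show "card (B - {c}) < card B" by (rule card_Diff1_less[OF B(1) c(1)])
        show "card (B - {c}) < card J" using B(1) c(1) I(2) cB J(2) by simp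
        have "span (L \<union> B) \<subseteq> span (?L \<union> (B - {c}))"
          by (rule span_minimal)
            (use span_superset[of "insert c L"] span_superset[of "?L \<union> (B - {c})"] in auto)
        then show "span (?L \<union> (B - {c})) = UNIV" using B(2) by blast
        show "{x. a + f x \<in> W} \<noteq> {}"
          using fix_slice[of "m u"] e(3)[of u] \<delta>(2) mW by (metis empty_iff mem_Collect_eq)
        show "{x. a + f x \<in> W} \<subseteq> {x. a + f x \<in> U j}" if "j \<in> J" for j
          using U(4)[of j] that J(3) by blast
        show "m (p' j) \<in> {x. a + f x \<in> U j}" if "j \<in> J" for j
          using fix_slice[OF gm[OF that]] mU[OF that] by simp
        show "{x. a + f x \<in> U i} \<inter> {x. a + f x \<in> U j} \<subseteq> {x. a + f x \<in> W}"
          if "i \<in> J" "j \<in> J" "i \<noteq> j" for i j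
          using meet[of i j] that J(3) by blast
      qed (use B(1) J W U f in \<open>auto intro!: inv convex_affine_vimage alg_open_affine_vimage\<close>)
      then obtain x where x: "x \<in> convex hull ((\<lambda>j. m (p' j)) ` J)" "a + f x \<in> W" by blast
      \<comment> \<open>The hull of the new points lies in \<open>C\<close> and in the slice, where
        the projection is the identity; a point of it projected into \<open>W\<close> would lie in
        both \<open>C\<close> and \<open>W\<close>.\<close>
      have "convex hull ((\<lambda>j. m (p' j)) ` J) \<subseteq> C \<inter> {x. g x = g z - \<delta>}"
        by (rule hull_minimal) (use mC gm cC convex_linear_level[OF g(1)] in \<open>auto intro: convex_Int\<close>)
      then have "x \<in> C" "a + f x = x" using x(1) fix_slice by auto
      then show False using x(2) CW by auto
    qed
  qed
qed


section \<open>Separation of two sets and the bound for the code\<close>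

lemma alg_open_Int:
  assumes "alg_open S" "alg_open T"
  shows "alg_open (S \<inter> T)"
  unfolding alg_open_def
proof (intro ballI allI)
  fix x v assume x: "x \<in> S \<inter> T"
  obtain d where d: "d > 0" "\<And>t. 0 \<le> t \<Longrightarrow> t \<le> d \<Longrightarrow> x + t *\<^sub>R v \<in> S"
    using alg_openD[OF assms(1)] x by (metis IntD1)
  obtain e where e: "e > 0" "\<And>t. 0 \<le> t \<Longrightarrow> t \<le> e \<Longrightarrow> x + t *\<^sub>R v \<in> T"
    using alg_openD[OF assms(2)] x by (metis IntD2)
  show "\<exists>e>0. \<forall>t. 0 \<le> t \<and> t \<le> e \<longrightarrow> x + t *\<^sub>R v \<in> S \<inter> T"
    using d e by (intro exI[of _ "min d e"]) auto
qed

lemma alg_open_INT: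
  assumes "finite J" "\<And>j. j \<in> J \<Longrightarrow> alg_open (U j)"
  shows "alg_open (\<Inter>j\<in>J. U j)"
  using assms
proof (induction J)
  case empty
  show ?case by (auto simp: alg_open_def intro: exI[of _ 1])
next
  case (insert j J)
  then show ?case by (auto intro!: alg_open_Int)
qed

text \<open>The difference set is a union of translates of \<open>S\<close>, hence open along lines,
  and it misses \<open>L\<close> because \<open>T\<close> is invariant. The supremum
  \<open>b\<close> of \<open>g\<close> on \<open>T\<close> is not attained, as \<open>T\<close> is
  open in the direction of a point of \<open>S\<close>, where \<open>g\<close> is larger.\<close>

lemma separate_sets:
  fixes S T :: "'a::real_vector set"
  assumes S: "convex S" "alg_open S" "S \<noteq> {}" and T: "convex T" "alg_open T" "invariant_under L T" "T \<noteq> {}"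
    and disj: "S \<inter> T = {}"
    and L: "subspace L" and B: "finite B" "span (L \<union> B) = UNIV"
  obtains g :: "'a \<Rightarrow> real" and b where "linear g" "\<And>x. x \<in> S \<Longrightarrow> b \<le> g x" "\<And>x. x \<in> T \<Longrightarrow> g x < b"
proof -
  let ?D = "\<Union>x\<in>S. \<Union>y\<in>T. {x - y}"
  have "?D = (\<Union>y\<in>T. {w. y + id w \<in> S})"
  proof (intro set_eqI iffI)
    fix w assume "w \<in> ?D"
    then obtain x y where "x \<in> S" "y \<in> T" "w = x - y" by blast
    then show "w \<in> (\<Union>y\<in>T. {w. y + id w \<in> S})" by (intro UN_I[of y]) auto
  next
    fix w assume "w \<in> (\<Union>y\<in>T. {w. y + id w \<in> S})"
    then obtain y where "y \<in> T" "y + id w \<in> S" by blast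
    then show "w \<in> ?D" by (intro UN_I[of "y + id w"] UN_I[of y]) auto
  qed
  then have "alg_open ?D"
    using S(2) by (auto intro!: alg_open_UN alg_open_affine_vimage linearI)
  moreover have "convex ?D" using S(1) T(1) by (rule convex_differences)
  moreover have "?D \<inter> L = {}"
  proof -
    have False if "x \<in> S" "y \<in> T" "x - y \<in> L" for x y
    proof -
      have "y + (x - y) \<in> T" using that(2,3) T(3) unfolding invariant_under_def by blast
      then show False using that(1) disj by auto
    qed
    then show ?thesis by blast
  qed
  ultimately obtain g where g: "linear g" "\<And>x. x \<in> ?D \<Longrightarrow> (g x :: real) > 0"
    using positive_functional[OF _ _ L _ B] by metis
  have less: "g y < g x" if "x \<in> S" "y \<in> T" for x y
    using g(2)[of "x - y"] that by (auto simp: linear_diff[OF g(1)])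
  obtain x0 where x0: "x0 \<in> S" using S(3) by blast
  have bdd: "bdd_above (g ` T)" using less[OF x0] by (auto intro!: bdd_aboveI less_imp_le)
  define b where "b = Sup (g ` T)"
  have "b \<le> g x" if "x \<in> S" for x
    unfolding b_def using that less T(4) by (intro cSUP_least) (auto intro: less_imp_le)
  moreover have "g y < b" if y: "y \<in> T" for y
  proof -
    obtain e where e: "e > 0" "\<And>t. 0 \<le> t \<Longrightarrow> t \<le> e \<Longrightarrow> y + t *\<^sub>R (x0 - y) \<in> T"
      using alg_openD[OF T(2) y] by metis
    have "g (y + e *\<^sub>R (x0 - y)) \<le> b"
      unfolding b_def using e bdd by (intro cSUP_upper) auto
    moreover have "g y < g (y + e *\<^sub>R (x0 - y))"
      using e(1) less[OF x0 y]
      by (simp add: linear_add[OF g(1)] linear_scale[OF g(1)] linear_diff[OF g(1)])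
    ultimately show ?thesis by simp
  qed
  ultimately show ?thesis using that g(1) by blast
qed

text \<open>Pairs and singletons contain at most one number of each parity. This turns the sets with
  odd index into a sunflower.\<close>

lemma code_T_two_odd:
  assumes "\<sigma> \<in> code_T n" "2 * k - 1 \<in> \<sigma>" "2 * l - 1 \<in> \<sigma>" "k \<noteq> l" "k \<ge> 1" "l \<ge> 1"
  shows "\<sigma> = {2 * k - 1 | k. k \<in> {1..n}}"
  using assms unfolding code_T_def by (auto; presburger)

lemma code_T_two_even:
  assumes "\<sigma> \<in> code_T n" "2 * k \<in> \<sigma>" "2 * l \<in> \<sigma>" "k \<noteq> l" "k \<ge> 1" "l \<ge> 1"
  shows "\<sigma> = {2 * k | k. k \<in> {1..n}}"
  using assms unfolding code_T_def by (auto; presburger)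

text \<open>\<open>word\<close> and \<open>real\<close> together say that the code of the cover is
  exactly \<open>code_T n\<close>; the codimension bound \<open>card B\<close> stands in for the
  dimension.\<close>

lemma code_T_codimension_bound:
  fixes U :: "nat \<Rightarrow> 'a::real_vector set"
  assumes B: "finite B" "span (L \<union> B) = UNIV" and L: "subspace L" and n: "n \<ge> 1"
    and U: "\<And>i. i \<in> {1..2 * n} \<Longrightarrow> convex (U i)" "\<And>i. i \<in> {1..2 * n} \<Longrightarrow> alg_open (U i)"
      "\<And>i. i \<in> {1..2 * n} \<Longrightarrow> invariant_under L (U i)"
    and word: "\<And>x. {i \<in> {1..2 * n}. x \<in> U i} \<in> code_T n"
    and real: "\<And>\<sigma>. \<sigma> \<in> code_T n \<Longrightarrow> \<exists>x. {i \<in> {1..2 * n}. x \<in> U i} = \<sigma>"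
  shows "n \<le> 2 * card B"
proof (rule ccontr)
  assume "\<not> ?thesis"
  then have nB: "n > 2 * card B" by simp
  have inv: "x \<in> U i \<longleftrightarrow> y \<in> U i" if "i \<in> {1..2 * n}" "x - y \<in> L" for x y i
  proof -
    have "y + (x - y) \<in> U i" if "y \<in> U i"
      using U(3)[OF \<open>i \<in> {1..2 * n}\<close>] that \<open>x - y \<in> L\<close> unfolding invariant_under_def by blast
    moreover have "x + - (x - y) \<in> U i" if "x \<in> U i"
      using U(3)[OF \<open>i \<in> {1..2 * n}\<close>] that subspace_neg[OF L \<open>x - y \<in> L\<close>]
      unfolding invariant_under_def by blast
    ultimately show ?thesis by auto
  qed
  \<comment> \<open>In codimension 0 invariant sets are empty or everything, yet \<open>{}\<close>
    and \<open>{1}\<close> are both codewords. With \<open>n > 2 * card B\<close> this gives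
    \<open>n \<ge> 3\<close>, so the indices 1 and 2 exist when \<open>O1\<close> and
    \<open>E1\<close> are shown to be disjoint.\<close>
  have "B \<noteq> {}"
  proof
    assume "B = {}"
    then have "L = UNIV" using B(2) L by (metis span_eq_iff sup_bot_right)
    moreover obtain x where "{i \<in> {1..2 * n}. x \<in> U i} = {}"
      using real[of "{}"] unfolding code_T_def by auto
    moreover obtain y where "{i \<in> {1..2 * n}. y \<in> U i} = {1}"
      using real[of "{1}"] n unfolding code_T_def by auto
    ultimately show False using inv[of 1 x y] n by auto
  qed
  then have n3: "n \<ge> 3" using nB B(1) by (cases "card B") auto
  define P where "P k = U (2 * k - 1)" for k
  define Q where "Q k = U (2 * k)" for k
  have P: "convex (P k)" "alg_open (P k)" "invariant_under L (P k)"
    and Q: "convex (Q k)" "alg_open (Q k)" "invariant_under L (Q k)" if "k \<in> {1..n}" for k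
  proof -
    have "2 * k - 1 \<in> {1..2 * n}" "2 * k \<in> {1..2 * n}" using that by auto
    then show "convex (P k)" "alg_open (P k)" "invariant_under L (P k)"
      "convex (Q k)" "alg_open (Q k)" "invariant_under L (Q k)"
      using U unfolding P_def Q_def by blast+
  qed
  define O1 where "O1 = (\<Inter>k\<in>{1..n}. P k)"
  define E1 where "E1 = (\<Inter>k\<in>{1..n}. Q k)"
  have word_odd: "{i \<in> {1..2 * n}. x \<in> U i} = {2 * k - 1 | k. k \<in> {1..n}}"
    if "x \<in> P k" "x \<in> P l" "k \<noteq> l" "k \<in> {1..n}" "l \<in> {1..n}" for x k l
    using that unfolding P_def by (intro code_T_two_odd[OF word, of k x l]) auto
  have word_even: "{i \<in> {1..2 * n}. x \<in> U i} = {2 * k | k. k \<in> {1..n}}"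
    if "x \<in> Q k" "x \<in> Q l" "k \<noteq> l" "k \<in> {1..n}" "l \<in> {1..n}" for x k l
    using that unfolding Q_def by (intro code_T_two_even[OF word, of k x l]) auto
  have PO: "P k \<inter> P l \<subseteq> O1" if "k \<in> {1..n}" "l \<in> {1..n}" "k \<noteq> l" for k l
    using word_odd[OF _ _ that(3,1,2)] unfolding O1_def P_def by blast
  have QE: "Q k \<inter> Q l \<subseteq> E1" if "k \<in> {1..n}" "l \<in> {1..n}" "k \<noteq> l" for k l
    using word_even[OF _ _ that(3,1,2)] unfolding E1_def Q_def by blast
  have disj: "O1 \<inter> E1 = {}"
  proof -
    have False if "x \<in> O1" "x \<in> E1" for x
    proof -
      have "{2 * k - 1 | k. k \<in> {1..n}} = {2 * k | k. k \<in> {1..n}}"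
        using word_odd[of x 1 2] word_even[of x 1 2] that n3 unfolding O1_def E1_def by auto
      moreover have "1 \<in> {2 * k - 1 | k. k \<in> {1..n}}" using n3 by force
      ultimately have "1 \<in> {2 * k | k. k \<in> {1..n}}" by metis
      then obtain k :: nat where "1 = 2 * k" by blast
      then show False by presburger
    qed
    then show ?thesis by blast
  qed
  have "\<exists>x. {i \<in> {1..2 * n}. x \<in> U i} = {2 * k - 1 | k. k \<in> {1..n}}"
    by (rule real) (simp add: code_T_def)
  then have O_ne: "O1 \<noteq> {}" unfolding O1_def P_def by blast
  have "\<exists>x. {i \<in> {1..2 * n}. x \<in> U i} = {2 * k | k. k \<in> {1..n}}"
    by (rule real) (simp add: code_T_def)
  then have E_ne: "E1 \<noteq> {}" unfolding E1_def Q_def by blast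
  have "\<exists>y. y \<in> P k \<inter> Q k" if "k \<in> {1..n}" for k
  proof -
    have "\<exists>y. {i \<in> {1..2 * n}. y \<in> U i} = {2 * k - 1, 2 * k}"
      by (rule real) (use that in \<open>auto simp: code_T_def\<close>)
    then show ?thesis unfolding P_def Q_def by blast
  qed
  then obtain y where y: "\<And>k. k \<in> {1..n} \<Longrightarrow> y k \<in> P k \<inter> Q k" by metis
  have O1: "convex O1" "alg_open O1" "invariant_under L O1"
    unfolding O1_def using P by (auto intro!: convex_INT alg_open_INT simp: invariant_under_def)
  have E1: "convex E1" "alg_open E1" "invariant_under L E1"
    unfolding E1_def using Q by (auto intro!: convex_INT alg_open_INT simp: invariant_under_def)
  have meetO: "convex hull (y ` K) \<inter> O1 \<noteq> {}" if K: "K \<subseteq> {1..n}" "card K > card B" for K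
  proof (rule sunflower_meets_center[OF B L finite_subset[OF K(1)] K(2) O1 O_ne, of P])
    show "O1 \<subseteq> P i" if "i \<in> K" for i using that K(1) unfolding O1_def by blast
  qed (use K(1) P PO y in \<open>blast+\<close>)
  have meetE: "convex hull (y ` K) \<inter> E1 \<noteq> {}" if K: "K \<subseteq> {1..n}" "card K > card B" for K
  proof (rule sunflower_meets_center[OF B L finite_subset[OF K(1)] K(2) E1 E_ne, of Q])
    show "E1 \<subseteq> Q i" if "i \<in> K" for i using that K(1) unfolding E1_def by blast
  qed (use K(1) Q QE y in \<open>blast+\<close>)
  obtain g b where g: "linear g" "\<And>x. x \<in> O1 \<Longrightarrow> (b::real) \<le> g x" "\<And>x. x \<in> E1 \<Longrightarrow> g x < b"
    using separate_sets[OF O1(1,2) O_ne E1 E_ne disj L B] by blast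
  \<comment> \<open>Pigeonhole: one side contains more than \<open>card B\<close> of the points
    \<open>y k\<close>. Their hull stays on that side and so misses the centre on the other
    one.\<close>
  let ?H = "{k \<in> {1..n}. g (y k) \<ge> b}" and ?K = "{k \<in> {1..n}. g (y k) < b}"
  have "card ?H + card ?K = card (?H \<union> ?K)" by (rule card_Un_disjoint[symmetric]) auto
  also have "?H \<union> ?K = {1..n}" by auto
  finally consider "card ?H > card B" | "card ?K > card B" using nB by fastforce
  then show False
  proof cases
    case 1
    have "convex hull (y ` ?H) \<subseteq> {x. g x \<ge> b}"
      by (intro hull_minimal convex_linear_level g(1)) auto
    then show False using meetE[OF _ 1] g(3) by fastforce
  next
    case 2
    have "convex hull (y ` ?K) \<subseteq> {x. g x < b}"
      by (intro hull_minimal convex_linear_level g(1)) auto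
    then show False using meetO[OF _ 2] g(2) by fastforce
  qed
qed

section \<open>Transfer from Euclidean space to the space of sequences\<close>

text \<open>The pointwise structure makes the abstract bound applicable to sequences and turns
  \<open>convex_fun\<close> into \<open>convex\<close>.\<close>

instantiation "fun" :: (type, real_vector) real_vector
begin

definition scaleR_fun :: "real \<Rightarrow> ('a \<Rightarrow> 'b) \<Rightarrow> 'a \<Rightarrow> 'b" where
  "scaleR_fun r f = (\<lambda>x. r *\<^sub>R f x)"

instance
  by standard (simp_all add: scaleR_fun_def fun_eq_iff scaleR_add_right scaleR_add_left)

end

lemma scaleR_fun_apply [simp]: "(r *\<^sub>R f) x = r *\<^sub>R f x"
  by (simp add: scaleR_fun_def)

text \<open>
  A set \<open>U\<close> in \<open>\<real>\<^sup>d\<close> becomes the cylinder \<open>{x. trunc d x \<in> U}\<close> in the space of all sequences.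
\<close>

definition trunc :: "nat \<Rightarrow> (nat \<Rightarrow> real) \<Rightarrow> nat \<Rightarrow> real" where
  "trunc d x = (\<lambda>i. if i < d then x i else 0)"

lemma linear_trunc: "linear (trunc d)"
  by (intro linearI) (auto simp: trunc_def)

lemma trunc_in_Euclidean_space: "trunc d x \<in> topspace (Euclidean_space d)"
  by (auto simp: trunc_def topspace_Euclidean_space)

lemma trunc_id: "x \<in> topspace (Euclidean_space d) \<Longrightarrow> trunc d x = x"
  by (auto simp: trunc_def topspace_Euclidean_space)

lemma convex_fun_iff_convex: "convex_fun S \<longleftrightarrow> convex S"
  unfolding convex_fun_def convex_def by (simp add: plus_fun_def scaleR_fun_def)

text \<open>A truncated line is continuous in each coordinate, hence into the product topology, from
  which \<open>Euclidean_space d\<close> inherits its open sets.\<close>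

lemma alg_open_trunc_vimage:
  assumes "openin (Euclidean_space d) U"
  shows "alg_open {x. trunc d x \<in> U}"
  unfolding alg_open_def
proof (intro ballI allI)
  fix x v :: "nat \<Rightarrow> real"
  assume x: "x \<in> {x. trunc d x \<in> U}"
  obtain V where V: "open V" "U = V \<inter> topspace (Euclidean_space d)"
    using assms unfolding topspace_Euclidean_space
    by (auto simp: Euclidean_space_def openin_subtopology euclidean_product_topology)
  define f where "f t = trunc d (x + t *\<^sub>R v)" for t
  have "continuous_on UNIV f"
  proof (rule continuous_on_coordinatewise_then_product)
    show "continuous_on UNIV (\<lambda>t. f t i)" for i
      by (cases "i < d") (auto simp: f_def trunc_def intro!: continuous_intros)
  qed
  then have "open (f -` V)" using V(1) by (rule open_vimage[rotated])
  moreover have "0 \<in> f -` V" using x V(2) by (simp add: f_def)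
  ultimately obtain e where e: "e > 0" "cball 0 e \<subseteq> f -` V"
    using open_contains_cball by blast
  have "x + t *\<^sub>R v \<in> {x. trunc d x \<in> U}" if "0 \<le> t" "t \<le> e" for t
    using e(2) that V(2) trunc_in_Euclidean_space unfolding f_def by (force simp: dist_real_def)
  then show "\<exists>e>0. \<forall>t. 0 \<le> t \<and> t \<le> e \<longrightarrow> x + t *\<^sub>R v \<in> {x. trunc d x \<in> U}"
    using e(1) by blast
qed

text \<open>The cylinders are invariant under the kernel \<open>L\<close> of \<open>trunc d\<close>,
  and \<open>L\<close> together with the first \<open>d\<close> unit vectors spans all
  sequences.\<close>

lemma code_T_realizable_imp:
  assumes n: "n \<ge> 1" and "open_convex_realizable (2 * n) (code_T n) d"
  shows "n \<le> 2 * d"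
proof -
  obtain U where U: "\<And>i. i \<in> {1..2 * n} \<Longrightarrow> openin (Euclidean_space d) (U i)"
      "\<And>i. i \<in> {1..2 * n} \<Longrightarrow> convex_fun (U i)"
    and code: "code_T n = code_of_cover d (2 * n) U"
    using assms(2) unfolding open_convex_realizable_def by blast
  \<comment> \<open>The summand 0 gives the set the shape of
    \<open>convex_affine_vimage\<close>.\<close>
  define V where "V i = {x. 0 + trunc d x \<in> U i}" for i
  define L where "L = {x. trunc d x = 0}"
  define b where "b i = (\<lambda>j. if j = i then 1 else 0 :: real)" for i :: nat
  let ?B = "b ` {..<d}"
  have L: "subspace L" unfolding L_def by (rule linear_subspace_kernel[OF linear_trunc])
  have "x \<in> span (L \<union> ?B)" for x
  proof -
    have "trunc d (x - trunc d x) = 0"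
      by (auto simp: trunc_def)
    then have "x - trunc d x \<in> span (L \<union> ?B)" unfolding L_def by (intro span_base) auto
    moreover have "trunc d x = (\<Sum>i<d. x i *\<^sub>R b i)"
    proof
      fix j
      have "(\<Sum>i<d. x i *\<^sub>R b i) j = (\<Sum>i<d. x i * b i j)"
        by (induction d) auto
      also have "\<dots> = trunc d x j" by (simp add: b_def trunc_def if_distrib cong: if_cong)
      finally show "trunc d x j = (\<Sum>i<d. x i *\<^sub>R b i) j" by simp
    qed
    then have "trunc d x \<in> span (L \<union> ?B)"
      using span_sum[of "{..<d}" "\<lambda>i. x i *\<^sub>R b i" "L \<union> ?B"] by (simp add: span_scale span_base)
    ultimately have "(x - trunc d x) + trunc d x \<in> span (L \<union> ?B)" by (rule span_add)
    then show ?thesis by simp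
  qed
  then have B: "span (L \<union> ?B) = UNIV" by blast
  have "n \<le> 2 * card ?B"
  proof (rule code_T_codimension_bound[OF _ B L n, of V])
    fix i assume i: "i \<in> {1..2 * n}"
    show "convex (V i)" unfolding V_def
      using U(2)[OF i] by (intro convex_affine_vimage linear_trunc) (simp add: convex_fun_iff_convex)
    show "alg_open (V i)" unfolding V_def using alg_open_trunc_vimage[OF U(1)[OF i]] by simp
    show "invariant_under L (V i)"
      unfolding V_def L_def invariant_under_def by (simp add: linear_add[OF linear_trunc])
  next
    fix x
    \<comment> \<open>The codeword of \<open>x\<close> for the cylinders is that of
      \<open>trunc d x\<close> for the cover.\<close>
    have "trunc d x \<in> (topspace (Euclidean_space d) \<inter> (\<Inter>i\<in>{i \<in> {1..2 * n}. x \<in> V i}. U i))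
        - (\<Union>j\<in>{1..2 * n} - {i \<in> {1..2 * n}. x \<in> V i}. U j)"
      using trunc_in_Euclidean_space by (auto simp: V_def)
    then show "{i \<in> {1..2 * n}. x \<in> V i} \<in> code_T n"
      unfolding code code_of_cover_def by blast
  next
    fix \<sigma> assume "\<sigma> \<in> code_T n"
    then obtain x where x: "\<sigma> \<subseteq> {1..2 * n}" "x \<in> topspace (Euclidean_space d)" "x \<in> (\<Inter>i\<in>\<sigma>. U i)"
        "x \<notin> (\<Union>j\<in>{1..2 * n} - \<sigma>. U j)"
      unfolding code code_of_cover_def by blast
    then have "{i \<in> {1..2 * n}. x \<in> V i} = \<sigma>" using trunc_id[OF x(2)] by (auto simp: V_def)
    then show "\<exists>x. {i \<in> {1..2 * n}. x \<in> V i} = \<sigma>" by blast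
  qed simp
  also have "card ?B \<le> d" using card_image_le[of "{..<d}" b] by simp
  finally show ?thesis by simp
qed

theorem theorem8p4:
  shows "(\<forall>n\<ge>1. t_seq n \<ge> enat (nat \<lceil>real n / 2\<rceil>)) \<and>
         (\<forall>B::nat. \<exists>n\<ge>1. t_seq n > enat B)"
proof -
  have bound: "t_seq n \<ge> enat (nat \<lceil>real n / 2\<rceil>)" if "n \<ge> 1" for n
    unfolding t_seq_def odim_def
  \<comment> \<open>It suffices to bound each realizing dimension; if there is none, the infimum is
    \<open>\<infinity>\<close> and the bound holds as well.\<close>
  proof (rule Inf_greatest)
    fix e assume "e \<in> {enat d | d. open_convex_realizable (2 * n) (code_T n) d}"
    then obtain d where d: "e = enat d" "n \<le> 2 * d" using code_T_realizable_imp[OF \<open>n \<ge> 1\<close>] by blast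
    then have "real n / 2 \<le> real d" by linarith
    then have "nat \<lceil>real n / 2\<rceil> \<le> d" by (simp add: ceiling_le_iff)
    then show "enat (nat \<lceil>real n / 2\<rceil>) \<le> e" using d(1) by simp
  qed
  \<comment> \<open>The index \<open>2 * B + 2\<close> is positive and its half is exactly
    \<open>B + 1\<close>.\<close>
  have "enat B < t_seq (2 * B + 2)" for B
  proof -
    have "real (2 * B + 2) / 2 = real (B + 1)" by simp
    then have "nat \<lceil>real (2 * B + 2) / 2\<rceil> = B + 1" by (simp only: ceiling_of_nat nat_int)
    then have "enat (B + 1) \<le> t_seq (2 * B + 2)" using bound[of "2 * B + 2"] by simp
    then show ?thesis by (metis enat_ord_simps(2) less_add_one order_less_le_trans)
  qed
  then show ?thesis using bound by (auto intro!: exI[of _ "2 * _ + 2"])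
qed

end
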